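(* Let $\boldsymbol{\Delta}(\varepsilon)\in\mathrm{GL}(N,\mathbb{K}(\varepsilon))$ be the intersection matrix, computed in bases in which the differential equation (with matrix $\varepsilon\boldsymbol{A}(\boldsymbol{x})$) and the dual differential equation (with matrix $\varepsilon\check{\boldsymbol{A}}(\boldsymbol{x})$) are both $\varepsilon$-factorised and in C-form, as described in the context. Then $\boldsymbol{\Delta}(\varepsilon)$ can be written as a product $$\boldsymbol{\Delta}(\varepsilon)=\boldsymbol{\Delta}_0\,\widetilde{\boldsymbol{\Delta}}(\varepsilon),$$ where $\boldsymbol{\Delta}_0\in\mathrm{GL}(N,\mathbb{K})$ is a constant matrix of full rank and $\widetilde{\boldsymbol{\Delta}}(\varepsilon)\in\mathrm{GL}(N,\mathbb{K}(\varepsilon))$ is a matrix of full rank that commutes with $\check{\boldsymbol{A}}(\boldsymbol{x})^T$.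
   Context: $\mathbb{K}\subset\mathbb{C}$ is an algebraic number field. $\boldsymbol{x}=(x_1,\dots,x_r)$ are local coordinates and $\mathrm{d}=\sum_k \mathrm{d}x_k\,\partial_{x_k}$ (acting on $\boldsymbol{x}$ only; $\varepsilon$ is a parameter). $\mathcal{A}$ is a $\mathbb{K}$-algebra of (analytic) functions of $\boldsymbol{x}$, closed under all $\partial_{x_k}$, whose constants are exactly $\mathbb{K}$. $\Omega^1(\mathcal{A})$ is the $\mathbb{K}$-vector space of one-forms $\sum_k \mathrm{d}x_k f_k$, $f_k\in\mathcal{A}$, and $Z^1(\mathcal{A})$ is its subspace of closed forms. $\mathcal{A}_\varepsilon=\mathcal{A}\otimes_{\mathbb{K}}\mathbb{K}(\varepsilon)$ and $\mathcal{F}_{\mathbb{C}}=\mathrm{Frac}(\mathbb{C}\otimes_{\mathbb{K}}\mathcal{A})$. Setting (Feynman integrals and their duals as periods of a (relative) twisted cohomology theory). $\boldsymbol{P}(\boldsymbol{x},\varepsilon)$ and $\check{\boldsymbol{P}}(\boldsymbol{x},\varepsilon)$ are the invertible $N\times N$ twisted period matrix and dual twisted period matrix, satisfying $\mathrm{d}\boldsymbol{P}=\boldsymbol{\Omega}\boldsymbol{P}$, $\mathrm{d}\check{\boldsymbol{P}}=\check{\boldsymbol{\Omega}}\check{\boldsymbol{P}}$ with matrices $\boldsymbol{\Omega}(\boldsymbol{x},\varepsilon),\check{\boldsymbol{\Omega}}(\boldsymbol{x},\varepsilon)$ of rational one-forms, rational in $\varepsilon$. $\boldsymbol{C}(\boldsymbol{x},\varepsilon)$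 is the (invertible) cohomology intersection matrix, with entries rational in $\boldsymbol{x}$, and $\boldsymbol{H}(\varepsilon)$ the (invertible, $\boldsymbol{x}$-independent) homology intersection matrix; they satisfy the twisted Riemann bilinear relations $(2\pi i)^{-n}\boldsymbol{P}(\boldsymbol{H}^{-1})^T\check{\boldsymbol{P}}^T=\boldsymbol{C}$ for a fixed integer $n$ (the degree of the cohomology), and $\mathrm{d}\boldsymbol{C}=\boldsymbol{\Omega}\boldsymbol{C}+\boldsymbol{C}\check{\boldsymbol{\Omega}}^T$. One assumes there are invertible matrices $\boldsymbol{S}(\boldsymbol{x},\varepsilon),\check{\boldsymbol{S}}(\boldsymbol{x},\varepsilon)$ such that $\boldsymbol{G}=\boldsymbol{S}^{-1}\boldsymbol{P}$ and $\check{\boldsymbol{G}}=\check{\boldsymbol{S}}^{-1}\check{\boldsymbol{P}}$ satisfy $\varepsilon$-factorised equations $$\mathrm{d}\boldsymbol{G}=\varepsilon\boldsymbol{A}(\boldsymbol{x})\boldsymbol{G},\qquad \mathrm{d}\check{\boldsymbol{G}}=\varepsilon\check{\boldsymbol{A}}(\boldsymbol{x})\check{\boldsymbol{G}},$$ where $\boldsymbol{A},\check{\boldsymbol{A}}$ are $N\times N$ matrices with entries in $Z^1(\mathcal{A})$ (satisfying $\boldsymbol{A}\wedge\boldsymbol{A}=0=\check{\boldsymbol{A}}\wedge\check{\boldsymbol{A}}$). Both are in C-form: the finite-dimensional $\mathbb{K}$-subspace $\mathbb{A}\subseteq Z^1(\mathcal{A})$ generated by the entries of $\boldsymbol{A}$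 and $\check{\boldsymbol{A}}$ satisfies $\mathbb{A}\cap\mathrm{d}\mathcal{F}_{\mathbb{C}}=\{0\}$. The intersection matrix in these bases is $\boldsymbol{\Delta}=\boldsymbol{S}^{-1}\boldsymbol{C}(\check{\boldsymbol{S}}^{-1})^T\in\mathrm{GL}(N,\mathcal{A}_\varepsilon)$; it satisfies $(2\pi i)^{-n}\boldsymbol{G}(\boldsymbol{H}^{-1})^T\check{\boldsymbol{G}}^T=\boldsymbol{\Delta}$ and $\mathrm{d}\boldsymbol{\Delta}=\varepsilon\boldsymbol{A}\boldsymbol{\Delta}+\varepsilon\boldsymbol{\Delta}\check{\boldsymbol{A}}^T$. In this setting $\mathrm{d}\boldsymbol{\Delta}=0$, so $\boldsymbol{\Delta}$ does not depend on $\boldsymbol{x}$, its entries lie in $\mathbb{K}(\varepsilon)$, and it is denoted $\boldsymbol{\Delta}(\varepsilon)$. *)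

theory Defs
  imports "HOL-Analysis.Analysis" "HOL-Computational_Algebra.Polynomial"
begin

section \<open>Number fields\<close>

definition number_field :: "complex set \<Rightarrow> bool" where
  "number_field K \<longleftrightarrow>
     0 \<in> K \<and> 1 \<in> K \<and>
     (\<forall>a\<in>K. \<forall>b\<in>K. a + b \<in> K \<and> a * b \<in> K) \<and>
     (\<forall>a\<in>K. - a \<in> K \<and> inverse a \<in> K) \<and>
     (\<exists>B. finite B \<and> B \<subseteq> K \<and>
        (\<forall>a\<in>K. \<exists>c :: complex \<Rightarrow> rat. a = (\<Sum>b\<in>B. of_rat (c b) * b)))"


section \<open>Differential calculus in complex coordinates\<close>

text \<open>
  A one-form \<open>\<Sum>\<^sub>k dx\<^sub>k f\<^sub>k\<close> is the vector field \<open>x \<mapsto> (f\<^sub>k x)\<^sub>k\<close> of its coefficients, and a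
  matrix of one-forms is, at each point, the vector of its coefficient matrices.
  All functions are total, but only their values on the coordinate domain \<open>U\<close> matter.
\<close>

type_synonym 'r form = "complex ^ 'r \<Rightarrow> complex ^ 'r"

text \<open>\<open>f\<close> is complex differentiable at \<open>x\<close> with \<open>df = \<Sum>\<^sub>k dx\<^sub>k w\<^sub>k\<close> there.\<close>

definition has_differential ::
    "(complex ^ 'r::finite \<Rightarrow> complex) \<Rightarrow> complex ^ 'r \<Rightarrow> complex ^ 'r \<Rightarrow> bool" where
  "has_differential f w x \<longleftrightarrow> (f has_derivative (\<lambda>h. \<Sum>k\<in>UNIV. h $ k * w $ k)) (at x)"

definition has_matrix_differential ::
    "(complex ^ 'r::finite \<Rightarrow> complex ^ 'n ^ 'n) \<Rightarrow> (complex ^ 'n ^ 'n) ^ 'r \<Rightarrow> complex ^ 'r \<Rightarrow> bool" where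
  "has_matrix_differential M W x \<longleftrightarrow>
     (\<forall>i j. has_differential (\<lambda>y. M y $ i $ j) (\<chi> k. W $ k $ i $ j) x)"

text \<open>On open sets, complex differentiability is the same as analyticity.\<close>

definition analytic_fun :: "(complex ^ 'r) set \<Rightarrow> (complex ^ 'r::finite \<Rightarrow> complex) \<Rightarrow> bool" where
  "analytic_fun U f \<longleftrightarrow> (\<forall>x\<in>U. \<exists>w. has_differential f w x)"

definition partial :: "'r \<Rightarrow> (complex ^ 'r::finite \<Rightarrow> complex) \<Rightarrow> complex ^ 'r \<Rightarrow> complex" where
  "partial k f x = deriv (\<lambda>z. f (x + axis k z)) 0"

text \<open>
  A \<open>K\<close>-algebra of analytic functions on the connected open set \<open>U\<close>, closed under all partial
  derivatives, with field of constants \<open>K\<close>.  Functions agreeing on \<open>U\<close> are identified by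
  requiring membership to depend on the values on \<open>U\<close> only.
\<close>

definition differential_algebra ::
    "complex set \<Rightarrow> (complex ^ 'r) set \<Rightarrow> (complex ^ 'r::finite \<Rightarrow> complex) set \<Rightarrow> bool" where
  "differential_algebra K U \<A> \<longleftrightarrow>
     (\<forall>f\<in>\<A>. analytic_fun U f) \<and>
     (\<forall>f\<in>\<A>. \<forall>g. (\<forall>x\<in>U. g x = f x) \<longrightarrow> g \<in> \<A>) \<and>
     (\<forall>f\<in>\<A>. \<forall>g\<in>\<A>. (\<lambda>x. f x + g x) \<in> \<A> \<and> (\<lambda>x. f x * g x) \<in> \<A>) \<and>
     (\<forall>c. (\<lambda>x. c) \<in> \<A> \<longleftrightarrow> c \<in> K) \<and>
     (\<forall>f\<in>\<A>. \<forall>k. partial k f \<in> \<A>)"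

definition closed_forms ::
    "(complex ^ 'r) set \<Rightarrow> (complex ^ 'r::finite \<Rightarrow> complex) set \<Rightarrow> 'r form set" where
  "closed_forms U \<A> =
     {w. (\<forall>k. (\<lambda>x. w x $ k) \<in> \<A>) \<and>
         (\<forall>x\<in>U. \<forall>k l. partial k (\<lambda>y. w y $ l) x = partial l (\<lambda>y. w y $ k) x)}"


section \<open>Exact forms over the fraction field, and the C-form condition\<close>

text \<open>\<open>\<complex> \<otimes>\<^sub>K \<A>\<close>, realised as the complex linear span of \<open>\<A>\<close> among the functions on \<open>U\<close>.\<close>

definition complexification ::
    "(complex ^ 'r) set \<Rightarrow> (complex ^ 'r::finite \<Rightarrow> complex) set \<Rightarrow> (complex ^ 'r \<Rightarrow> complex) set" where
  "complexification U \<A> =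
     {g. \<exists>F c. finite F \<and> F \<subseteq> \<A> \<and> (\<forall>x\<in>U. g x = (\<Sum>f\<in>F. c f * f x))}"

text \<open>
  The forms \<open>d(g/h)\<close> with \<open>g/h\<close> in the fraction field of \<open>complexification U \<A>\<close>.  The element
  \<open>g/h\<close> is a meromorphic function; the identity between forms is required wherever \<open>h\<close> does
  not vanish, which is a dense subset of \<open>U\<close>.
\<close>

definition exact_forms_Frac ::
    "(complex ^ 'r) set \<Rightarrow> (complex ^ 'r::finite \<Rightarrow> complex) set \<Rightarrow> 'r form set" where
  "exact_forms_Frac U \<A> =
     {w. \<exists>g\<in>complexification U \<A>. \<exists>h\<in>complexification U \<A>.
           (\<exists>x\<in>U. h x \<noteq> 0) \<and>
           (\<forall>x\<in>U. h x \<noteq> 0 \<longrightarrow> has_differential (\<lambda>y. g y / h y) (w x) x)}"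

definition form_span ::
    "complex set \<Rightarrow> (complex ^ 'r) set \<Rightarrow> 'r::finite form set \<Rightarrow> 'r form set" where
  "form_span K U V =
     {w. \<exists>F c. finite F \<and> F \<subseteq> V \<and> (\<forall>v\<in>F. c v \<in> K) \<and>
           (\<forall>x\<in>U. \<forall>k. w x $ k = (\<Sum>v\<in>F. c v * v x $ k))}"

definition matrix_form_entry ::
    "(complex ^ 'r::finite \<Rightarrow> (complex ^ 'n ^ 'n) ^ 'r) \<Rightarrow> 'n \<Rightarrow> 'n \<Rightarrow> 'r form" where
  "matrix_form_entry W i j = (\<lambda>x. \<chi> k. W x $ k $ i $ j)"

definition matrix_form_entries ::
    "(complex ^ 'r::finite \<Rightarrow> (complex ^ 'n ^ 'n) ^ 'r) \<Rightarrow> 'r form set" where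
  "matrix_form_entries W = {matrix_form_entry W i j | i j. True}"

text \<open>The matrix-valued two-form \<open>W \<and> W\<close> vanishes on \<open>U\<close>: all its coefficients
  \<open>W\<^sub>k W\<^sub>l - W\<^sub>l W\<^sub>k\<close> do.\<close>

definition wedge_square_zero ::
    "(complex ^ 'r) set \<Rightarrow> (complex ^ 'r::finite \<Rightarrow> (complex ^ 'n ^ 'n) ^ 'r) \<Rightarrow> bool" where
  "wedge_square_zero U W \<longleftrightarrow> (\<forall>x\<in>U. \<forall>k l. W x $ k ** W x $ l - W x $ l ** W x $ k = 0)"

text \<open>Both differential equations are in C-form: \<open>\<AA> \<inter> d\<F>\<^sub>\<complex> = {0}\<close>, where \<open>\<AA>\<close> is spanned over
  \<open>K\<close> by the entries of both matrices.  Vanishing of a form means vanishing on \<open>U\<close>.\<close>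

definition jointly_in_C_form ::
    "complex set \<Rightarrow> (complex ^ 'r) set \<Rightarrow> (complex ^ 'r::finite \<Rightarrow> complex) set \<Rightarrow>
     (complex ^ 'r \<Rightarrow> (complex ^ 'n ^ 'n) ^ 'r) \<Rightarrow> (complex ^ 'r \<Rightarrow> (complex ^ 'n ^ 'n) ^ 'r) \<Rightarrow> bool" where
  "jointly_in_C_form K U \<A> A A' \<longleftrightarrow>
     form_span K U (matrix_form_entries A \<union> matrix_form_entries A') \<inter> exact_forms_Frac U \<A>
       = {w. \<forall>x\<in>U. w x = 0}"


section \<open>Rational dependence on the parameter and on the coordinates\<close>

text \<open>
  The parameter ranges over an open set \<open>E\<close> containing no pole.  As \<open>E\<close> is infinite, elements
  of \<open>K(\<epsilon>)\<close>, and of \<open>\<A> \<otimes>\<^sub>K K(\<epsilon>)\<close>, are determined by their values on \<open>E\<close>, respectively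
  on \<open>U \<times> E\<close>.
\<close>

definition rational_functions_over :: "complex set \<Rightarrow> complex set \<Rightarrow> (complex \<Rightarrow> complex) set" where
  "rational_functions_over K E =
     {r. \<exists>p q. (\<forall>i. coeff p i \<in> K) \<and> (\<forall>i. coeff q i \<in> K) \<and>
           (\<forall>e\<in>E. poly q e \<noteq> 0 \<and> r e = poly p e / poly q e)}"

definition algebra_eps ::
    "complex set \<Rightarrow> (complex ^ 'r) set \<Rightarrow> (complex ^ 'r::finite \<Rightarrow> complex) set \<Rightarrow> complex set \<Rightarrow>
     ((complex ^ 'r) \<times> complex \<Rightarrow> complex) set" where
  "algebra_eps K U \<A> E =
     {F. \<exists>(m::nat) f r. (\<forall>j<m. f j \<in> \<A> \<and> r j \<in> rational_functions_over K E) \<and>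
           (\<forall>x\<in>U. \<forall>e\<in>E. F (x, e) = (\<Sum>j<m. f j x * r j e))}"

text \<open>\<open>GL(N, R)\<close> for a ring \<open>R\<close> of functions on \<open>D\<close>: both the matrix and its inverse have entries
  in \<open>R\<close>.\<close>

definition GL_functions ::
    "'a set \<Rightarrow> ('a \<Rightarrow> complex) set \<Rightarrow> ('a \<Rightarrow> complex ^ 'n::finite ^ 'n) set" where
  "GL_functions D R =
     {M. (\<forall>i j. (\<lambda>z. M z $ i $ j) \<in> R) \<and>
         (\<exists>M'. (\<forall>i j. (\<lambda>z. M' z $ i $ j) \<in> R) \<and>
               (\<forall>z\<in>D. M z ** M' z = mat 1 \<and> M' z ** M z = mat 1))}"

text \<open>\<open>GL(N, K)\<close>; for a field \<open>K\<close> the inverse automatically has entries in \<open>K\<close>.\<close>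

definition GL_field :: "complex set \<Rightarrow> (complex ^ 'n::finite ^ 'n) set" where
  "GL_field K = {M. (\<forall>i j. M $ i $ j \<in> K) \<and> invertible M}"

text \<open>The polynomial functions in the coordinate functions \<open>X\<close>.\<close>

inductive_set polynomials_in :: "('a \<Rightarrow> complex) set \<Rightarrow> ('a \<Rightarrow> complex) set"
  for X :: "('a \<Rightarrow> complex) set" where
  coord: "f \<in> X \<Longrightarrow> f \<in> polynomials_in X"
| const: "(\<lambda>z. c) \<in> polynomials_in X"
| add: "f \<in> polynomials_in X \<Longrightarrow> g \<in> polynomials_in X \<Longrightarrow> (\<lambda>z. f z + g z) \<in> polynomials_in X"
| mult: "f \<in> polynomials_in X \<Longrightarrow> g \<in> polynomials_in X \<Longrightarrow> (\<lambda>z. f z * g z) \<in> polynomials_in X"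

definition rational_on :: "'a set \<Rightarrow> ('a \<Rightarrow> complex) set \<Rightarrow> ('a \<Rightarrow> complex) set" where
  "rational_on D X =
     {f. \<exists>p\<in>polynomials_in X. \<exists>q\<in>polynomials_in X. \<forall>z\<in>D. q z \<noteq> 0 \<and> f z = p z / q z}"

definition coords :: "(complex ^ 'r \<Rightarrow> complex) set" where
  "coords = range (\<lambda>k x. x $ k)"

definition coords_eps :: "((complex ^ 'r) \<times> complex \<Rightarrow> complex) set" where
  "coords_eps = insert snd (range (\<lambda>k z. fst z $ k))"

abbreviation scale_matrix :: "complex \<Rightarrow> complex ^ 'n ^ 'n \<Rightarrow> complex ^ 'n::finite ^ 'n" where
  "scale_matrix c M \<equiv> map_matrix ((*) c) M"

end

theory Submission
  imports Defs
begin

text \<open>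
  The product rule and the bilinear relations give
  \<open>d\<Delta> = \<epsilon> (A \<Delta> + \<Delta> A'\<^sup>T)\<close>.  After clearing denominators, \<open>Q(\<epsilon>) \<Delta> = \<Sum>\<^sub>k \<epsilon>\<^sup>k M\<^sub>k\<close> with entries of
  \<open>M\<^sub>k\<close> in the algebra, and comparing coefficients yields \<open>dM\<^sub>0 = 0\<close> and
  \<open>dM\<^sub>k\<^sub>+\<^sub>1 = A M\<^sub>k + M\<^sub>k A'\<^sup>T\<close>.  Inductively \<open>M\<^sub>k\<close> is constant, so the right-hand side
  lies in the span of the entries of \<open>A\<close> and \<open>A'\<close> and is exact, hence zero.  Thus every
  specialisation of \<open>M(\<epsilon>) = \<Sum>\<^sub>k \<epsilon>\<^sup>k M\<^sub>k\<close> intertwines \<open>A\<close> with \<open>- A'\<^sup>T\<close>.  Taking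
  \<open>\<Delta>\<^sub>0 = M(m)\<close> for a natural number \<open>m\<close> that is not a root of \<open>det M\<close>, the quotient
  \<open>\<Delta>\<^sub>0\<^sup>-\<^sup>1 \<Delta>\<close> commutes with \<open>A'\<^sup>T\<close>.
\<close>

section \<open>Differentials\<close>

lemma has_differential_unique:
  assumes "has_differential f v x" "has_differential f w x"
  shows "v = w"
proof -
  have eq: "(\<lambda>h. \<Sum>k\<in>UNIV. h $ k * v $ k) = (\<lambda>h. \<Sum>k\<in>UNIV. h $ k * w $ k)"
    using assms unfolding has_differential_def by (rule has_derivative_unique)
  have "(\<Sum>k\<in>UNIV. axis l 1 $ k * u $ k) = u $ l" for l and u :: "complex ^ 'r"
    by (simp add: axis_def if_distrib[of "\<lambda>z. z * _"] cong: if_cong)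
  then show ?thesis
    using fun_cong[OF eq, of "axis _ 1"] by (metis vec_eq_iff)
qed

lemma has_differential_const: "has_differential (\<lambda>y. c) 0 x"
  unfolding has_differential_def by simp

lemma has_differential_mult:
  assumes "has_differential f v x" "has_differential g w x"
  shows "has_differential (\<lambda>y. f y * g y) (\<chi> k. v $ k * g x + f x * w $ k) x"
proof -
  have "((\<lambda>y. f y * g y) has_derivative
      (\<lambda>h. f x * (\<Sum>k\<in>UNIV. h $ k * w $ k) + (\<Sum>k\<in>UNIV. h $ k * v $ k) * g x)) (at x)"
    using assms unfolding has_differential_def by (intro has_derivative_mult) auto
  then show ?thesis
    unfolding has_differential_def
    by (rule has_derivative_eq_rhs)
      (simp add: fun_eq_iff sum_distrib_left sum_distrib_right sum.distrib[symmetric] algebra_simps)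
qed

lemma has_differential_cmult:
  assumes "has_differential f w x"
  shows "has_differential (\<lambda>y. c * f y) (\<chi> k. c * w $ k) x"
  using has_differential_mult[OF has_differential_const assms] by simp

lemma has_differential_sum:
  assumes "\<And>a. a \<in> I \<Longrightarrow> has_differential (f a) (w a) x"
  shows "has_differential (\<lambda>y. \<Sum>a\<in>I. f a y) (\<chi> k. \<Sum>a\<in>I. w a $ k) x"
proof -
  have "((\<lambda>y. \<Sum>a\<in>I. f a y) has_derivative (\<lambda>h. \<Sum>a\<in>I. \<Sum>k\<in>UNIV. h $ k * w a $ k)) (at x)"
    using assms unfolding has_differential_def by (intro has_derivative_sum) auto
  then show ?thesis
    unfolding has_differential_def
    by (rule has_derivative_eq_rhs) (simp add: fun_eq_iff sum_distrib_left sum.swap[of _ I])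
qed

lemma has_differential_transform:
  assumes "has_differential f w x" "open U" "x \<in> U" "\<And>y. y \<in> U \<Longrightarrow> f y = g y"
  shows "has_differential g w x"
  using assms unfolding has_differential_def
  by (blast intro: has_derivative_transform_within_open)

lemma has_differential_zero_constant:
  assumes "open U" "connected U" "\<And>x. x \<in> U \<Longrightarrow> has_differential f 0 x" "x \<in> U" "y \<in> U"
  shows "f x = f y"
  using assms(1,2) _ assms(4,5)
proof (rule has_derivative_zero_unique_connected)
  show "(f has_derivative (\<lambda>h. 0)) (at z)" if "z \<in> U" for z
    using assms(3)[OF that] unfolding has_differential_def by simp
qed

lemma has_matrix_differential_const:
  fixes x :: "complex ^ 'r::finite" and Z :: "complex ^ 'n::finite ^ 'n"
  shows "has_matrix_differential (\<lambda>y. Z) 0 x"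
proof -
  have "(\<chi> k. 0) = (0 :: complex ^ 'r)"
    by (simp add: vec_eq_iff)
  then show ?thesis
    unfolding has_matrix_differential_def by (simp add: has_differential_const)
qed

lemma has_matrix_differential_mult:
  assumes "has_matrix_differential M V x" "has_matrix_differential N W x"
  shows "has_matrix_differential (\<lambda>y. M y ** N y) (\<chi> k. V $ k ** N x + M x ** W $ k) x"
  unfolding has_matrix_differential_def
proof (intro allI)
  fix i j
  have "has_differential (\<lambda>y. \<Sum>a\<in>UNIV. M y $ i $ a * N y $ a $ j)
      (\<chi> k. \<Sum>a\<in>UNIV. (\<chi> k. (\<chi> k. V $ k $ i $ a) $ k * N x $ a $ j
        + M x $ i $ a * (\<chi> k. W $ k $ a $ j) $ k) $ k) x"
    using assms unfolding has_matrix_differential_def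
    by (intro has_differential_sum has_differential_mult) auto
  then show "has_differential (\<lambda>y. (M y ** N y) $ i $ j)
      (\<chi> k. (\<chi> k. V $ k ** N x + M x ** W $ k) $ k $ i $ j) x"
    by (simp add: matrix_matrix_mult_def sum.distrib)
qed

lemma has_matrix_differential_transpose:
  assumes "has_matrix_differential M W x"
  shows "has_matrix_differential (\<lambda>y. transpose (M y)) (\<chi> k. transpose (W $ k)) x"
  using assms unfolding has_matrix_differential_def by (simp add: transpose_def)

lemma has_matrix_differential_transform:
  assumes "has_matrix_differential M W x" "open U" "x \<in> U" "\<And>y. y \<in> U \<Longrightarrow> M y = N y"
  shows "has_matrix_differential N W x"
  using assms unfolding has_matrix_differential_def
  by (blast intro: has_differential_transform[where U = U] arg_cong[of _ _ "\<lambda>X. X $ _ $ _"])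

lemma has_matrix_differential_scale:
  assumes "has_matrix_differential M W x"
  shows "has_matrix_differential (\<lambda>y. scale_matrix c (M y)) (\<chi> k. scale_matrix c (W $ k)) x"
  unfolding has_matrix_differential_def
proof (intro allI)
  fix i j
  have "has_differential (\<lambda>y. c * M y $ i $ j) (\<chi> k. c * (\<chi> k. W $ k $ i $ j) $ k) x"
    using assms unfolding has_matrix_differential_def by (intro has_differential_cmult) blast
  then show "has_differential (\<lambda>y. scale_matrix c (M y) $ i $ j)
      (\<chi> k. (\<chi> k. scale_matrix c (W $ k)) $ k $ i $ j) x"
    by (simp add: map_matrix_def)
qed

section \<open>Scalar multiples of matrices and the differential of a bilinear pairing\<close>

lemma scale_matrix_mult_left: "scale_matrix c X ** Y = scale_matrix c (X ** Y)"
  by (simp add: vec_eq_iff matrix_matrix_mult_def map_matrix_def sum_distrib_left mult.assoc)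

lemma scale_matrix_mult_right: "X ** scale_matrix c Y = scale_matrix c (X ** Y)"
  by (simp add: vec_eq_iff matrix_matrix_mult_def map_matrix_def sum_distrib_left mult.left_commute)

lemma scale_matrix_add: "scale_matrix c (X + Y) = scale_matrix c X + scale_matrix c Y"
  by (simp add: vec_eq_iff map_matrix_def distrib_left)

lemma scale_matrix_commute: "scale_matrix b (scale_matrix c X) = scale_matrix c (scale_matrix b X)"
  by (simp add: vec_eq_iff map_matrix_def mult.left_commute)

lemma transpose_scale_matrix: "transpose (scale_matrix c X) = scale_matrix c (transpose X)"
  by (simp add: vec_eq_iff map_matrix_def transpose_def)

text \<open>Since \<open>Z\<close> is constant, only the outer factors contribute to the product
  rule, and transposing the dual equation moves \<open>A'\<close> to the right. With
  \<open>Z\<close> a multiple of the transposed inverse of \<open>H\<close>, this becomes the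
  equation for \<open>\<Delta>\<close>.\<close>

lemma has_matrix_differential_bilinear:
  assumes "has_matrix_differential G (\<chi> k. scale_matrix e (A $ k) ** G x) x"
    and "has_matrix_differential G' (\<chi> k. scale_matrix e (A' $ k) ** G' x) x"
  shows "has_matrix_differential (\<lambda>y. G y ** Z ** transpose (G' y))
    (\<chi> k. scale_matrix e (A $ k ** (G x ** Z ** transpose (G' x))
      + G x ** Z ** transpose (G' x) ** transpose (A' $ k))) x"
  using has_matrix_differential_mult[OF has_matrix_differential_mult[OF assms(1)
      has_matrix_differential_const[of Z]] has_matrix_differential_transpose[OF assms(2)]]
  by (simp add: scale_matrix_mult_left scale_matrix_mult_right scale_matrix_add
      transpose_scale_matrix matrix_transpose_mul matrix_mul_assoc)


section \<open>Subrings, determinants and Cramer's rule\<close>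

text \<open>Membership has to be tracked both for numbers in \<open>K\<close> and for polynomials
  with coefficients in \<open>K\<close>; an arbitrary subring covers both.\<close>

locale subring_set =
  fixes S :: "'a::comm_ring_1 set"
  assumes zero_mem: "0 \<in> S" and one_mem: "1 \<in> S"
    and add_mem: "a \<in> S \<Longrightarrow> b \<in> S \<Longrightarrow> a + b \<in> S"
    and mult_mem: "a \<in> S \<Longrightarrow> b \<in> S \<Longrightarrow> a * b \<in> S"
    and uminus_mem: "a \<in> S \<Longrightarrow> - a \<in> S"
begin

lemma sum_mem: "(\<And>i. i \<in> I \<Longrightarrow> f i \<in> S) \<Longrightarrow> sum f I \<in> S"
  by (induction I rule: infinite_finite_induct) (auto intro: zero_mem add_mem)

lemma prod_mem: "(\<And>i. i \<in> I \<Longrightarrow> f i \<in> S) \<Longrightarrow> prod f I \<in> S"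
  by (induction I rule: infinite_finite_induct) (auto intro: one_mem mult_mem)

lemma power_mem: "a \<in> S \<Longrightarrow> a ^ m \<in> S"
  by (induction m) (auto intro: one_mem mult_mem)

lemma of_nat_mem: "of_nat m \<in> S"
  by (induction m) (auto intro: zero_mem one_mem add_mem)

lemma of_int_mem: "of_int m \<in> S"
  by (cases m) (auto intro: of_nat_mem uminus_mem simp del: of_nat_Suc)

lemma det_mem: "(\<And>i j. M $ i $ j \<in> S) \<Longrightarrow> det M \<in> S"
  unfolding det_def by (intro sum_mem mult_mem prod_mem of_int_mem)

lemma poly_mem: "(\<And>i. coeff p i \<in> S) \<Longrightarrow> a \<in> S \<Longrightarrow> poly p a \<in> S"
  unfolding poly_altdef by (intro sum_mem mult_mem power_mem)

lemma poly_subring: "subring_set {p. \<forall>i. coeff p i \<in> S}"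
proof
  show "1 \<in> {p. \<forall>i. coeff p i \<in> S}"
    by (auto simp: coeff_1 intro: zero_mem one_mem)
qed (auto intro!: zero_mem add_mem uminus_mem sum_mem mult_mem simp: coeff_mult)

end

lemma number_field_subring: "number_field K \<Longrightarrow> subring_set K"
  unfolding number_field_def by unfold_locales auto

text \<open>This is the adjugate of \<open>M\<close>. Being free of division, it makes sense over
  polynomial rings and stays inside any subring containing the entries of \<open>M\<close>.\<close>

definition cramer_matrix :: "'a::comm_ring_1 ^ 'n ^ 'n \<Rightarrow> 'a ^ 'n ^ 'n" where
  "cramer_matrix M = (\<chi> i j. det (\<chi> a b. if b = i then mat 1 $ a $ j else M $ a $ b))"

text \<open>By Cramer's rule, column \<open>j\<close> of \<open>B\<close> solves the linear system
  whose right-hand side is the \<open>j\<close>-th unit vector. For square matrices a right inverse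
  is also a left inverse.\<close>

lemma cramer_matrix_inverse:
  fixes M :: "'a::field ^ 'n ^ 'n"
  assumes "det M \<noteq> 0"
  defines "B \<equiv> (\<chi> i j. cramer_matrix M $ i $ j / det M)"
  shows "M ** B = mat 1" "B ** M = mat 1"
proof -
  have col: "M *v column j B = column j (mat 1)" for j
    using cramer[OF assms(1), of "column j B" "column j (mat 1)"]
    by (simp add: B_def cramer_matrix_def column_def cong: if_cong)
  show *: "M ** B = mat 1"
  proof -
    have "(M ** B) $ i $ j = (M *v column j B) $ i" for i j
      by (simp add: matrix_matrix_mult_def matrix_vector_mult_def column_def)
    then show ?thesis
      unfolding col by (simp add: vec_eq_iff column_def)
  qed
  then show "B ** M = mat 1"
    by (simp add: matrix_left_right_inverse)
qed

lemma (in subring_set) cramer_matrix_mem: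
  "(\<And>i j. M $ i $ j \<in> S) \<Longrightarrow> cramer_matrix M $ i $ j \<in> S"
  unfolding cramer_matrix_def by (auto simp: mat_def intro!: det_mem zero_mem one_mem)

definition poly_matrix :: "'a::comm_ring_1 poly ^ 'n ^ 'n \<Rightarrow> 'a \<Rightarrow> 'a ^ 'n ^ 'n" where
  "poly_matrix M e = (\<chi> i j. poly (M $ i $ j) e)"

lemma poly_det: "poly (det M) e = det (poly_matrix M e)"
  by (simp add: det_def poly_matrix_def poly_sum poly_prod)

text \<open>Evaluation is a ring homomorphism, so it commutes with determinants. Hence the pointwise
  inverse of a polynomial matrix is rational in the parameter.\<close>

lemma poly_cramer_matrix: "poly (cramer_matrix M $ i $ j) e = cramer_matrix (poly_matrix M e) $ i $ j"
proof -
  have "poly_matrix (\<chi> a b. if b = i then mat 1 $ a $ j else M $ a $ b) e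
      = (\<chi> a b. if b = i then mat 1 $ a $ j else poly_matrix M e $ a $ b)"
    by (simp add: vec_eq_iff poly_matrix_def mat_def)
  then show ?thesis
    by (simp add: cramer_matrix_def poly_det)
qed

lemma poly_eqI_infinite:
  fixes p q :: "'a::idom poly"
  assumes "infinite E" "\<And>e. e \<in> E \<Longrightarrow> poly p e = poly q e"
  shows "p = q"
proof (rule ccontr)
  assume "p \<noteq> q"
  then have "finite {e. poly (p - q) e = 0}"
    by (intro poly_roots_finite) simp
  with assms show False
    by (auto dest!: finite_subset[of E, rotated])
qed


section \<open>Polynomials with coefficients in the algebra\<close>

text \<open>A model of the polynomial ring over \<open>\<A>\<close> in the parameter. The degree
  bound is uniform in \<open>x\<close>, so that finitely many coefficient functions describe the
  whole family.\<close>

definition poly_families :: "('b \<Rightarrow> complex) set \<Rightarrow> ('b \<Rightarrow> complex poly) set" where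
  "poly_families \<A> =
     {h. (\<forall>k. (\<lambda>x. coeff (h x) k) \<in> \<A>) \<and> (\<exists>d. \<forall>x. degree (h x) \<le> d)}"

context
  fixes K U and \<A> :: "(complex ^ 'r::finite \<Rightarrow> complex) set"
  assumes K: "number_field K" and \<A>: "differential_algebra K U \<A>"
begin

interpretation subring_set K
  using K by (rule number_field_subring)

lemma const_mem_algebra: "(\<lambda>x. c) \<in> \<A> \<longleftrightarrow> c \<in> K"
  using \<A> unfolding differential_algebra_def by blast

lemma add_mem_algebra: "f \<in> \<A> \<Longrightarrow> g \<in> \<A> \<Longrightarrow> (\<lambda>x. f x + g x) \<in> \<A>"
  using \<A> unfolding differential_algebra_def by blast

lemma mult_mem_algebra: "f \<in> \<A> \<Longrightarrow> g \<in> \<A> \<Longrightarrow> (\<lambda>x. f x * g x) \<in> \<A>"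
  using \<A> unfolding differential_algebra_def by blast

lemma algebra_cong: "f \<in> \<A> \<Longrightarrow> (\<And>x. x \<in> U \<Longrightarrow> g x = f x) \<Longrightarrow> g \<in> \<A>"
  using \<A> unfolding differential_algebra_def by blast

lemma algebra_has_differential: "f \<in> \<A> \<Longrightarrow> x \<in> U \<Longrightarrow> \<exists>w. has_differential f w x"
  using \<A> unfolding differential_algebra_def analytic_fun_def by blast

lemma sum_mem_algebra: "(\<And>i. i \<in> I \<Longrightarrow> f i \<in> \<A>) \<Longrightarrow> (\<lambda>x. \<Sum>i\<in>I. f i x) \<in> \<A>"
  by (induction I rule: infinite_finite_induct)
    (auto intro: add_mem_algebra simp: const_mem_algebra zero_mem)

lemma poly_families_zero: "(\<lambda>x. 0) \<in> poly_families \<A>"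
  by (auto simp: poly_families_def const_mem_algebra zero_mem)

lemma poly_families_add:
  assumes "g \<in> poly_families \<A>" "h \<in> poly_families \<A>"
  shows "(\<lambda>x. g x + h x) \<in> poly_families \<A>"
proof -
  from assms obtain c d where "degree (g x) \<le> c" "degree (h x) \<le> d" for x
    unfolding poly_families_def by blast
  then have "degree (g x + h x) \<le> max c d" for x
    by (meson degree_add_le max.coboundedI1 max.coboundedI2)
  with assms show ?thesis
    unfolding poly_families_def by (auto intro: add_mem_algebra)
qed

lemma poly_families_constant_poly:
  assumes "f \<in> \<A>"
  shows "(\<lambda>x. [:f x:]) \<in> poly_families \<A>"
proof -
  have "(\<lambda>x. coeff [:f x:] k) \<in> \<A>" for k
    using assms by (cases k) (auto simp: const_mem_algebra zero_mem)
  then show ?thesis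
    unfolding poly_families_def by auto
qed

lemma poly_families_mult:
  assumes "h \<in> poly_families \<A>" "\<And>i. coeff p i \<in> K"
  shows "(\<lambda>x. p * h x) \<in> poly_families \<A>"
proof -
  from assms(1) obtain d where d: "\<And>x. degree (h x) \<le> d"
    unfolding poly_families_def by blast
  have "degree (p * h x) \<le> degree p + d" for x
    using degree_mult_le[of p "h x"] d[of x] by linarith
  moreover have "(\<lambda>x. coeff (p * h x) k) \<in> \<A>" for k
    using assms unfolding coeff_mult poly_families_def
    by (intro sum_mem_algebra mult_mem_algebra) (auto simp: const_mem_algebra)
  ultimately show ?thesis
    unfolding poly_families_def by blast
qed

lemma poly_mult_coeffs_mem:
  assumes "\<And>i. coeff p i \<in> K" "\<And>i. coeff q i \<in> K"
  shows "coeff (p * q) i \<in> K"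
  using subring_set.mult_mem[OF poly_subring, of p q] assms by blast

text \<open>Induction on the number of terms, collecting the denominators of the \<open>r j\<close>.
  These involve the parameter only, so \<open>Q\<close> does not depend on \<open>x\<close>.\<close>

lemma algebra_eps_clear_denominator:
  assumes "F \<in> algebra_eps K U \<A> E"
  obtains Q h where "\<And>i. coeff Q i \<in> K" "\<And>e. e \<in> E \<Longrightarrow> poly Q e \<noteq> 0" "h \<in> poly_families \<A>"
    "\<And>x e. x \<in> U \<Longrightarrow> e \<in> E \<Longrightarrow> poly Q e * F (x, e) = poly (h x) e"
proof -
  from assms obtain m :: nat and f r
    where fr: "\<And>j. j < m \<Longrightarrow> f j \<in> \<A> \<and> r j \<in> rational_functions_over K E"
      and F: "\<And>x e. x \<in> U \<Longrightarrow> e \<in> E \<Longrightarrow> F (x, e) = (\<Sum>j<m. f j x * r j e)"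
    unfolding algebra_eps_def by blast
  from fr have "\<exists>Q h. (\<forall>i. coeff Q i \<in> K) \<and> (\<forall>e\<in>E. poly Q e \<noteq> 0) \<and> h \<in> poly_families \<A>
      \<and> (\<forall>x\<in>U. \<forall>e\<in>E. poly Q e * (\<Sum>j<m. f j x * r j e) = poly (h x) e)"
  proof (induction m)
    case 0
    have "\<forall>i. coeff (1 :: complex poly) i \<in> K"
      by (auto simp: coeff_1 intro: zero_mem one_mem)
    then show ?case
      using poly_families_zero by (intro exI[of _ 1] exI[of _ "\<lambda>x. 0"]) auto
  next
    case (Suc m)
    then obtain Q h where Q: "\<And>i. coeff Q i \<in> K" "\<And>e. e \<in> E \<Longrightarrow> poly Q e \<noteq> 0"
      and h: "h \<in> poly_families \<A>"
      and Qh: "\<And>x e. x \<in> U \<Longrightarrow> e \<in> E \<Longrightarrow> poly Q e * (\<Sum>j<m. f j x * r j e) = poly (h x) e"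
      by force
    from Suc.prems[of m] obtain p q where pq: "\<And>i. coeff p i \<in> K" "\<And>i. coeff q i \<in> K"
      and r: "\<And>e. e \<in> E \<Longrightarrow> poly q e \<noteq> 0 \<and> r m e = poly p e / poly q e"
      unfolding rational_functions_over_def by blast
    \<comment> \<open>Over the denominator \<open>q * Q\<close>, the old sum has numerator
      \<open>q * h x\<close> and the new term has numerator \<open>Q * p\<close> times
      \<open>f m x\<close>.\<close>
    let ?h = "\<lambda>x. q * h x + Q * p * [:f m x:]"
    have "?h \<in> poly_families \<A>"
      using Suc.prems[of m] h Q pq
      by (intro poly_families_add poly_families_mult poly_mult_coeffs_mem poly_families_constant_poly) auto
    moreover have "poly (q * Q) e * (\<Sum>j<Suc m. f j x * r j e) = poly (?h x) e"
      if "x \<in> U" "e \<in> E" for x e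
      using Qh[OF that, symmetric] r[OF that(2)] by (simp add: field_simps)
    moreover have "\<forall>i. coeff (q * Q) i \<in> K" "\<forall>e\<in>E. poly (q * Q) e \<noteq> 0"
      using Q pq r by (auto intro: poly_mult_coeffs_mem)
    ultimately show ?case
      by (intro exI[of _ "q * Q"] exI[of _ ?h]) auto
  qed
  with F that show ?thesis
    by (metis (no_types, lifting))
qed

text \<open>The product of the finitely many individual denominators works; each numerator is
  multiplied by the denominators of the other indices.\<close>

lemma algebra_eps_common_denominator:
  fixes F :: "'i::finite \<Rightarrow> (complex ^ 'r) \<times> complex \<Rightarrow> complex"
  assumes "\<And>i. F i \<in> algebra_eps K U \<A> E"
  obtains Q h where "\<And>k. coeff Q k \<in> K" "\<And>e. e \<in> E \<Longrightarrow> poly Q e \<noteq> 0" "\<And>i. h i \<in> poly_families \<A>"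
    "\<And>i x e. x \<in> U \<Longrightarrow> e \<in> E \<Longrightarrow> poly Q e * F i (x, e) = poly (h i x) e"
proof -
  have "\<exists>Q h. (\<forall>k. coeff Q k \<in> K) \<and> (\<forall>e\<in>E. poly Q e \<noteq> 0) \<and> h \<in> poly_families \<A>
      \<and> (\<forall>x\<in>U. \<forall>e\<in>E. poly Q e * F i (x, e) = poly (h x) e)" for i
    using algebra_eps_clear_denominator[OF assms, of i] by metis
  then obtain Q h where Q: "\<And>i k. coeff (Q i) k \<in> K" "\<And>i e. e \<in> E \<Longrightarrow> poly (Q i) e \<noteq> 0"
    and h: "\<And>i. h i \<in> poly_families \<A>"
    and Qh: "\<And>i x e. x \<in> U \<Longrightarrow> e \<in> E \<Longrightarrow> poly (Q i) e * F i (x, e) = poly (h i x) e"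
    by metis
  define R where "R I = (\<Prod>i\<in>I. Q i)" for I
  have R: "coeff (R I) k \<in> K" for I k
    using subring_set.prod_mem[OF poly_subring, of I Q] Q(1) unfolding R_def by blast
  show thesis
  proof
    show "coeff (R UNIV) k \<in> K" for k
      by (rule R)
    show "poly (R UNIV) e \<noteq> 0" if "e \<in> E" for e
      using Q(2) that by (simp add: R_def poly_prod)
    show "(\<lambda>x. R (UNIV - {i}) * h i x) \<in> poly_families \<A>" for i
      using h R by (rule poly_families_mult)
    show "poly (R UNIV) e * F i (x, e) = poly (R (UNIV - {i}) * h i x) e" if "x \<in> U" "e \<in> E" for i x e
    proof -
      have "R UNIV = Q i * R (UNIV - {i})"
        unfolding R_def by (rule prod.remove) auto
      then show ?thesis
        using Qh[OF that, of i, symmetric] by simp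
    qed
  qed
qed


section \<open>Closed forms in the span and exact forms\<close>

lemma form_span_base: "v \<in> V \<Longrightarrow> v \<in> form_span K U V"
  unfolding form_span_def
  by (intro CollectI exI[of _ "{v}"] exI[of _ "\<lambda>_. 1"]) (auto simp: one_mem)

lemma form_span_cong:
  "w \<in> form_span K U V \<Longrightarrow> (\<And>x. x \<in> U \<Longrightarrow> w' x = w x) \<Longrightarrow> w' \<in> form_span K U V"
  unfolding form_span_def by auto

lemma form_span_scale:
  assumes "w \<in> form_span K U V" "a \<in> K"
  shows "(\<lambda>x. \<chi> k. a * w x $ k) \<in> form_span K U V"
proof -
  from assms(1) obtain F c where "finite F" "F \<subseteq> V" "\<forall>v\<in>F. c v \<in> K"
    "\<forall>x\<in>U. \<forall>k. w x $ k = (\<Sum>v\<in>F. c v * v x $ k)"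
    unfolding form_span_def by blast
  with assms(2) show ?thesis
    unfolding form_span_def
    by (intro CollectI exI[of _ F] exI[of _ "\<lambda>v. a * c v"])
      (auto intro: mult_mem simp: sum_distrib_left mult.assoc)
qed

lemma form_span_add:
  assumes "v \<in> form_span K U V" "w \<in> form_span K U V"
  shows "(\<lambda>x. v x + w x) \<in> form_span K U V"
proof -
  from assms(1) obtain F c where F: "finite F" "F \<subseteq> V" "\<forall>u\<in>F. c u \<in> K"
    "\<forall>x\<in>U. \<forall>k. v x $ k = (\<Sum>u\<in>F. c u * u x $ k)"
    unfolding form_span_def by blast
  from assms(2) obtain G d where G: "finite G" "G \<subseteq> V" "\<forall>u\<in>G. d u \<in> K"
    "\<forall>x\<in>U. \<forall>k. w x $ k = (\<Sum>u\<in>G. d u * u x $ k)"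
    unfolding form_span_def by blast
  \<comment> \<open>The supports \<open>F\<close> and \<open>G\<close> may overlap: coefficients add
    up there and default to 0 outside their own support.\<close>
  define b where "b u = (if u \<in> F then c u else 0) + (if u \<in> G then d u else 0)" for u
  have "(\<Sum>u\<in>F \<union> G. b u * u x $ k) = (\<Sum>u\<in>F. c u * u x $ k) + (\<Sum>u\<in>G. d u * u x $ k)" for x k
  proof -
    have "(\<Sum>u\<in>F \<union> G. b u * u x $ k)
        = (\<Sum>u\<in>F \<union> G. if u \<in> F then c u * u x $ k else 0)
          + (\<Sum>u\<in>F \<union> G. if u \<in> G then d u * u x $ k else 0)"
      unfolding sum.distrib[symmetric] by (intro sum.cong) (auto simp: b_def distrib_right)
    also have "\<dots> = (\<Sum>u\<in>F. c u * u x $ k) + (\<Sum>u\<in>G. d u * u x $ k)"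
      using F(1) G(1) by (simp add: sum.inter_restrict[symmetric] Int_absorb1)
    finally show ?thesis .
  qed
  moreover have "b u \<in> K" for u
    using F(3) G(3) by (auto simp: b_def intro!: add_mem zero_mem)
  ultimately show ?thesis
    using F G unfolding form_span_def
    by (intro CollectI exI[of _ "F \<union> G"] exI[of _ b]) auto
qed

lemma form_span_sum:
  assumes "\<And>i. i \<in> I \<Longrightarrow> w i \<in> form_span K U V"
  shows "(\<lambda>x. \<Sum>i\<in>I. w i x) \<in> form_span K U V"
proof -
  have "(\<lambda>x. 0) \<in> form_span K U V"
    unfolding form_span_def by (intro CollectI exI[of _ "{}"]) auto
  with assms show ?thesis
    by (induction I rule: infinite_finite_induct) (auto intro: form_span_add)
qed

text \<open>Write \<open>f\<close> as the fraction \<open>f / 1\<close>; a point of \<open>U\<close>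
  witnesses that the denominator is nonzero.\<close>

lemma exact_forms_Frac_algebra:
  assumes "f \<in> \<A>" "U \<noteq> {}" "\<And>x. x \<in> U \<Longrightarrow> has_differential f (w x) x"
  shows "w \<in> exact_forms_Frac U \<A>"
proof -
  have "g \<in> complexification U \<A>" if "g \<in> \<A>" for g
    using that unfolding complexification_def
    by (intro CollectI exI[of _ "{g}"] exI[of _ "\<lambda>_. 1"]) auto
  moreover have "(\<lambda>x. 1) \<in> \<A>"
    by (simp add: const_mem_algebra one_mem)
  ultimately show ?thesis
    using assms unfolding exact_forms_Frac_def
    by (intro CollectI bexI[of _ f] bexI[of _ "\<lambda>x. 1"]) auto
qed

end

text \<open>Comparison of coefficients: for each \<open>e\<close> the differential of the evaluated
  polynomial is unique, which gives an equality of two polynomials at infinitely many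
  points.\<close>

lemma has_differential_coeff:
  assumes "infinite E" "\<And>y. degree (f y) \<le> d"
    and coeff: "\<And>k. \<exists>w. has_differential (\<lambda>y. coeff (f y) k) w x"
    and poly: "\<And>e. e \<in> E \<Longrightarrow> has_differential (\<lambda>y. poly (f y) e) (\<chi> l. poly (W l) e) x"
  shows "has_differential (\<lambda>y. coeff (f y) k) (\<chi> l. coeff (W l) k) x"
proof -
  from coeff obtain w where w: "\<And>k. has_differential (\<lambda>y. coeff (f y) k) (w k) x"
    by metis
  \<comment> \<open>Coefficients beyond the degree bound vanish identically, so truncating the sums
    at \<open>d\<close> loses nothing.\<close>
  have w0: "w k = 0" if "k > d" for k
  proof -
    have "(\<lambda>y. coeff (f y) k) = (\<lambda>y. 0)"
      using assms(2) that by (meson coeff_eq_0 le_less_trans)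
    with w[of k] show ?thesis
      using has_differential_unique has_differential_const by metis
  qed
  have poly_f: "poly (f y) e = (\<Sum>k\<le>d. e ^ k * coeff (f y) k)" for y e
    using poly_as_sum_of_monoms'[OF assms(2)[of y]]
    by (metis (no_types, lifting) poly_sum poly_monom mult.commute sum.cong)
  have "W l = (\<Sum>k\<le>d. monom (w k $ l) k)" for l
  proof (rule poly_eqI_infinite[OF assms(1)])
    fix e assume "e \<in> E"
    have "has_differential (\<lambda>y. poly (f y) e) (\<chi> l. \<Sum>k\<le>d. (\<chi> l. e ^ k * w k $ l) $ l) x"
      unfolding poly_f by (intro has_differential_sum has_differential_cmult w)
    from has_differential_unique[OF poly[OF \<open>e \<in> E\<close>] this]
    show "poly (W l) e = poly (\<Sum>k\<le>d. monom (w k $ l) k) e"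
      by (simp add: vec_eq_iff poly_sum poly_monom mult.commute)
  qed
  then have "coeff (W l) k = w k $ l" for l
    using w0 by (cases "k \<le> d") (auto simp: coeff_sum)
  with w[of k] show ?thesis
    by simp
qed


section \<open>The intersection matrix is constant\<close>

text \<open>The factor \<open>e\<close> on the right-hand side shifts degrees by one: nothing
  contributes in degree 0, and degree \<open>k\<close> determines the differential in degree
  \<open>Suc k\<close>.\<close>

lemma poly_matrix_differential_coeff:
  fixes Hm :: "complex ^ 'r::finite \<Rightarrow> complex poly ^ 'n::finite ^ 'n"
    and A A' :: "(complex ^ 'n ^ 'n) ^ 'r"
  assumes "infinite E" and K: "number_field K" "differential_algebra K U \<A>" and x: "x \<in> U"
    and Hm: "\<And>i j. (\<lambda>y. Hm y $ i $ j) \<in> poly_families \<A>"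
    and d: "\<And>e. e \<in> E \<Longrightarrow> has_matrix_differential (\<lambda>y. poly_matrix (Hm y) e)
      (\<chi> l. scale_matrix e (A $ l ** poly_matrix (Hm x) e
        + poly_matrix (Hm x) e ** transpose (A' $ l))) x"
  shows "has_differential (\<lambda>y. coeff (Hm y $ i $ j) 0) 0 x"
    and "has_differential (\<lambda>y. coeff (Hm y $ i $ j) (Suc k))
      (\<chi> l. (\<Sum>a\<in>UNIV. A $ l $ i $ a * coeff (Hm x $ a $ j) k)
        + (\<Sum>a\<in>UNIV. A' $ l $ j $ a * coeff (Hm x $ i $ a) k)) x"
proof -
  \<comment> \<open>The right-hand side as a polynomial in the parameter; \<open>pCons 0\<close> is
    multiplication by the parameter.\<close>
  define W where "W l = pCons 0 ((\<Sum>a\<in>UNIV. smult (A $ l $ i $ a) (Hm x $ a $ j))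
    + (\<Sum>a\<in>UNIV. smult (A' $ l $ j $ a) (Hm x $ i $ a)))" for l
  from Hm[of i j] obtain D where D: "\<And>y. degree (Hm y $ i $ j) \<le> D"
    unfolding poly_families_def by blast
  have *: "has_differential (\<lambda>y. coeff (Hm y $ i $ j) k) (\<chi> l. coeff (W l) k) x" for k
  proof (rule has_differential_coeff[OF assms(1) D])
    show "\<exists>w. has_differential (\<lambda>y. coeff (Hm y $ i $ j) k) w x" for k
      using Hm[of i j] unfolding poly_families_def
      by (intro algebra_has_differential[OF K _ x]) blast
    show "has_differential (\<lambda>y. poly (Hm y $ i $ j) e) (\<chi> l. poly (W l) e) x" if "e \<in> E" for e
      using d[OF that] unfolding has_matrix_differential_def
      by (auto simp: poly_matrix_def W_def poly_sum map_matrix_def matrix_matrix_mult_def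
          transpose_def mult.commute dest!: spec[of _ i] spec[of _ j])
  qed
  from *[of 0] show "has_differential (\<lambda>y. coeff (Hm y $ i $ j) 0) 0 x"
    by (simp add: W_def zero_vec_def)
  from *[of "Suc k"] show "has_differential (\<lambda>y. coeff (Hm y $ i $ j) (Suc k))
      (\<chi> l. (\<Sum>a\<in>UNIV. A $ l $ i $ a * coeff (Hm x $ a $ j) k)
        + (\<Sum>a\<in>UNIV. A' $ l $ j $ a * coeff (Hm x $ i $ a) k)) x"
    by (simp add: W_def coeff_sum)
qed

text \<open>Induction on the order in the parameter, with the C-form condition annihilating each
  differential. The final relation is an identity of polynomials and thus holds for every
  \<open>e\<close>, including values outside \<open>E\<close>.\<close>

lemma poly_matrix_constant:
  fixes Hm :: "complex ^ 'r::finite \<Rightarrow> complex poly ^ 'n::finite ^ 'n"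
    and A A' :: "complex ^ 'r \<Rightarrow> (complex ^ 'n ^ 'n) ^ 'r"
  assumes E: "infinite E" and K: "number_field K" "differential_algebra K U \<A>"
    and U: "open U" "connected U" "U \<noteq> {}"
    and C_form: "jointly_in_C_form K U \<A> A A'"
    and Hm: "\<And>i j. (\<lambda>y. Hm y $ i $ j) \<in> poly_families \<A>"
    and d: "\<And>x e. x \<in> U \<Longrightarrow> e \<in> E \<Longrightarrow> has_matrix_differential (\<lambda>y. poly_matrix (Hm y) e)
      (\<chi> l. scale_matrix e (A x $ l ** poly_matrix (Hm x) e
        + poly_matrix (Hm x) e ** transpose (A' x $ l))) x"
  obtains M where "\<And>i j k. coeff (M $ i $ j) k \<in> K" "\<And>x. x \<in> U \<Longrightarrow> Hm x = M"
    "\<And>x l e. x \<in> U \<Longrightarrow> A x $ l ** poly_matrix M e = - (poly_matrix M e ** transpose (A' x $ l))"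
proof -
  interpret subring_set K
    using K(1) by (rule number_field_subring)
  \<comment> \<open>\<open>R i j k\<close> is the order-\<open>k\<close> part of entry
    \<open>(i, j)\<close> of \<open>A Hm + Hm A'^T\<close>, read as a one-form.\<close>
  define R where "R i j k x = (\<chi> l. (\<Sum>a\<in>UNIV. A x $ l $ i $ a * coeff (Hm x $ a $ j) k)
        + (\<Sum>a\<in>UNIV. A' x $ l $ j $ a * coeff (Hm x $ i $ a) k))" for i j k x
  have d0: "has_differential (\<lambda>y. coeff (Hm y $ i $ j) 0) 0 x" if "x \<in> U" for x i j
    by (rule poly_matrix_differential_coeff[OF E K that Hm d[OF that]])
  have dS: "has_differential (\<lambda>y. coeff (Hm y $ i $ j) (Suc k)) (R i j k x) x" if "x \<in> U" for x i j k
    unfolding R_def by (rule poly_matrix_differential_coeff[OF E K that Hm d[OF that]])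
  have coeff_mem: "(\<lambda>y. coeff (Hm y $ i $ j) k) \<in> \<A>" for i j k
    using Hm unfolding poly_families_def by blast
  have constant_coeff: "\<exists>c\<in>K. \<forall>x\<in>U. coeff (Hm x $ i $ j) k = c"
    if zero: "\<And>x. x \<in> U \<Longrightarrow> has_differential (\<lambda>y. coeff (Hm y $ i $ j) k) 0 x" for i j k
  proof -
    obtain u where "u \<in> U"
      using U by blast
    then have eq: "coeff (Hm x $ i $ j) k = coeff (Hm u $ i $ j) k" if "x \<in> U" for x
      using has_differential_zero_constant[OF U(1,2) zero that] \<open>u \<in> U\<close> by blast
    \<comment> \<open>Membership in \<open>\<A>\<close> depends only on values on \<open>U\<close>,
      so the constant function belongs to \<open>\<A>\<close>; its value is then in
      \<open>K\<close>, the constants of \<open>\<A>\<close>.\<close>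
    then have "(\<lambda>x. coeff (Hm u $ i $ j) k) \<in> \<A>"
      by (intro algebra_cong[OF K coeff_mem[of i j k]]) simp
    with eq show ?thesis
      by (auto simp: const_mem_algebra[OF K])
  qed
  have R_zero: "R i j k x = 0"
    if const: "\<And>i j. \<exists>c\<in>K. \<forall>x\<in>U. coeff (Hm x $ i $ j) k = c" and x: "x \<in> U" for i j k x
  proof -
    let ?V = "matrix_form_entries A \<union> matrix_form_entries A'"
    obtain c where c: "\<And>i j. c i j \<in> K" "\<And>i j x. x \<in> U \<Longrightarrow> coeff (Hm x $ i $ j) k = c i j"
      using const by metis
    \<comment> \<open>Once the coefficients of order \<open>k\<close> are constants in
      \<open>K\<close>, the form is a \<open>K\<close>-combination of entries of \<open>A\<close>
      and \<open>A'\<close>.\<close>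
    have "(\<lambda>x. (\<Sum>a\<in>UNIV. \<chi> l. c a j * matrix_form_entry A i a x $ l)
        + (\<Sum>a\<in>UNIV. \<chi> l. c i a * matrix_form_entry A' j a x $ l)) \<in> form_span K U ?V"
      using c(1)
      by (intro form_span_add[OF K] form_span_sum[OF K] form_span_scale[OF K] form_span_base[OF K])
        (auto simp: matrix_form_entries_def)
    then have "R i j k \<in> form_span K U ?V"
      by (rule form_span_cong[OF K])
        (simp add: R_def c(2) vec_eq_iff matrix_form_entry_def mult.commute)
    \<comment> \<open>The form is exact because it is the differential of the coefficient of order
      \<open>Suc k\<close>.\<close>
    moreover have "R i j k \<in> exact_forms_Frac U \<A>"
      using dS by (intro exact_forms_Frac_algebra[OF K coeff_mem U(3)])
    ultimately show ?thesis
      using C_form x unfolding jointly_in_C_form_def by blast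
  qed
  have all_const: "\<exists>c\<in>K. \<forall>x\<in>U. coeff (Hm x $ i $ j) k = c" for i j k
  proof (induction k arbitrary: i j)
    case 0
    show ?case
      by (intro constant_coeff d0)
  next
    case (Suc k)
    show ?case
      using dS[of _ i j k] R_zero[OF Suc] by (intro constant_coeff) simp
  qed
  obtain u where u: "u \<in> U"
    using U by blast
  show thesis
  proof
    show "coeff (Hm u $ i $ j) k \<in> K" for i j k
      using all_const[of i j k] u by auto
    show Hm_eq: "Hm x = Hm u" if "x \<in> U" for x
    proof -
      have "coeff (Hm x $ i $ j) k = coeff (Hm u $ i $ j) k" for i j k
        using all_const[of i j k] u that by metis
      then show ?thesis
        by (simp add: vec_eq_iff poly_eq_iff)
    qed
    show "A x $ l ** poly_matrix (Hm u) e = - (poly_matrix (Hm u) e ** transpose (A' x $ l))"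
      if "x \<in> U" for x l e
    proof -
      \<comment> \<open>All orders of \<open>R\<close> vanish, so the intertwining relation holds
        between polynomials before any evaluation.\<close>
      have "(\<Sum>a\<in>UNIV. smult (A x $ l $ i $ a) (Hm u $ a $ j))
          + (\<Sum>a\<in>UNIV. smult (A' x $ l $ j $ a) (Hm u $ i $ a)) = 0" (is "?p = 0") for i j
      proof (rule poly_eqI)
        fix k
        show "coeff ?p k = coeff 0 k"
          using R_zero[OF all_const that, of i j k] Hm_eq[OF that]
          by (simp add: R_def vec_eq_iff coeff_sum)
      qed
      then have "poly ((\<Sum>a\<in>UNIV. smult (A x $ l $ i $ a) (Hm u $ a $ j))
          + (\<Sum>a\<in>UNIV. smult (A' x $ l $ j $ a) (Hm u $ i $ a))) e = 0" for i j
        by simp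
      then show ?thesis
        by (simp add: vec_eq_iff poly_matrix_def matrix_matrix_mult_def transpose_def poly_sum
            eq_neg_iff_add_eq_0 mult.commute)
    qed
  qed
qed

section \<open>Splitting off a constant factor by specialising the parameter\<close>

text \<open>A nonzero polynomial has finitely many roots. A natural number is chosen because it lies
  in every number field \<open>K\<close>, so that specialising there stays over
  \<open>K\<close>.\<close>

lemma ex_nat_poly_nonzero:
  fixes p :: "'a::{idom,ring_char_0} poly"
  assumes "p \<noteq> 0"
  obtains m :: nat where "poly p (of_nat m) \<noteq> 0"
proof -
  have "infinite (range (of_nat :: nat \<Rightarrow> 'a))"
    by (simp add: range_inj_infinite inj_on_def)
  then have "\<not> range of_nat \<subseteq> {x. poly p x = 0}"
    using poly_roots_finite[OF assms] finite_subset by blast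
  with that show thesis
    by blast
qed

text \<open>Multiplying the first relation by \<open>M'\<close> on both sides gives
  \<open>M' A = - B M'\<close>; moving \<open>B\<close> past \<open>N\<close> and then past
  \<open>M'\<close> produces two signs, which cancel.\<close>

lemma intertwiner_quotient_commutes:
  fixes A B M N :: "'a::field ^ 'n ^ 'n"
  assumes "A ** M = - (M ** B)" "A ** N = - (N ** B)" and "M' ** M = mat 1" "M ** M' = mat 1"
  shows "(M' ** N) ** B = B ** (M' ** N)"
proof -
  have neg: "X ** (- Y) = - (X ** Y)" "(- X) ** Y = - (X ** Y)" for X Y :: "'a ^ 'n ^ 'n"
    by (simp_all add: vec_eq_iff matrix_matrix_mult_def sum_negf)
  have "M' ** A = M' ** (A ** M) ** M'"
    by (metis assms(4) matrix_mul_assoc matrix_mul_rid)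
  also have "\<dots> = - (B ** M')"
    by (metis assms(1,3) neg matrix_mul_assoc matrix_mul_lid)
  finally have *: "M' ** A = - (B ** M')" .
  have "(M' ** N) ** B = - (M' ** A ** N)"
    using assms(2) by (metis matrix_mul_assoc neg(1) minus_minus)
  also have "\<dots> = B ** (M' ** N)"
    by (simp add: * neg matrix_mul_assoc)
  finally show ?thesis .
qed

lemma rational_functions_overI:
  assumes "\<And>i. coeff p i \<in> K" "\<And>i. coeff q i \<in> K" "\<And>e. e \<in> E \<Longrightarrow> poly q e \<noteq> 0"
    "\<And>e. e \<in> E \<Longrightarrow> r e = poly p e / poly q e"
  shows "r \<in> rational_functions_over K E"
  using assms unfolding rational_functions_over_def by blast

text \<open>The constant factor is the specialisation \<open>M(m)\<close>. The other factor
  \<open>M(m)^-1 M(e) / Q(e)\<close> has inverse \<open>Q(e) M(e)^-1 M(m)\<close>, and the adjugate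
  shows that both are rational over \<open>K\<close>.\<close>

lemma factorise_poly_matrix:
  fixes M :: "complex poly ^ 'n::finite ^ 'n"
  assumes K: "number_field K" and E: "E \<noteq> {}"
    and M: "\<And>i j k. coeff (M $ i $ j) k \<in> K" and Q: "\<And>k. coeff Q k \<in> K"
    and Q0: "\<And>e. e \<in> E \<Longrightarrow> poly Q e \<noteq> 0" and det_M: "\<And>e. e \<in> E \<Longrightarrow> det (poly_matrix M e) \<noteq> 0"
  obtains m :: nat and \<Delta>\<^sub>0' where "poly_matrix M (of_nat m) \<in> GL_field K"
    "poly_matrix M (of_nat m) ** \<Delta>\<^sub>0' = mat 1" "\<Delta>\<^sub>0' ** poly_matrix M (of_nat m) = mat 1"
    "(\<lambda>e. \<Delta>\<^sub>0' ** scale_matrix (inverse (poly Q e)) (poly_matrix M e))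
      \<in> GL_functions E (rational_functions_over K E)"
proof -
  interpret subring_set K
    using K by (rule number_field_subring)
  interpret KX: subring_set "{p. \<forall>i. coeff p i \<in> K}"
    by (rule poly_subring)
  have smult_mem: "smult a p \<in> {p. \<forall>i. coeff p i \<in> K}" if "a \<in> K" "p \<in> {p. \<forall>i. coeff p i \<in> K}" for a p
    using that by (auto intro: mult_mem)
  \<comment> \<open>As \<open>E\<close> is nonempty, the determinant polynomial has a nonzero
    value.\<close>
  have "det M \<noteq> 0"
    using E det_M by (metis all_not_in_conv poly_0 poly_det)
  then obtain m :: nat where m: "poly (det M) (of_nat m) \<noteq> 0"
    by (rule ex_nat_poly_nonzero)
  define M0 where "M0 = poly_matrix M (of_nat m)"
  define M0' where "M0' = (\<chi> i j. cramer_matrix M0 $ i $ j / det M0)"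
  have det_M0: "det M0 \<noteq> 0"
    using m by (simp add: M0_def poly_det)
  note inv0 = cramer_matrix_inverse[OF det_M0, folded M0'_def]
  have M0_mem: "M0 $ i $ j \<in> K" for i j
    using M by (auto simp: M0_def poly_matrix_def intro!: poly_mem of_nat_mem)
  have M0'_mem: "M0' $ i $ j \<in> K" for i j
  proof -
    have "inverse (det M0) \<in> K"
      using K det_mem[of M0] M0_mem unfolding number_field_def by blast
    then show ?thesis
      using M0_mem by (auto simp: M0'_def divide_inverse intro!: mult_mem cramer_matrix_mem)
  qed
  define N where "N e = (\<chi> i j. cramer_matrix (poly_matrix M e) $ i $ j / det (poly_matrix M e))" for e
  have inv: "poly_matrix M e ** N e = mat 1" "N e ** poly_matrix M e = mat 1" if "e \<in> E" for e
    using cramer_matrix_inverse[OF det_M[OF that]] by (simp_all add: N_def)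
  let ?D = "\<lambda>e. M0' ** scale_matrix (inverse (poly Q e)) (poly_matrix M e)"
  let ?D' = "\<lambda>e. scale_matrix (poly Q e) (N e ** M0)"
  have scale_scale: "scale_matrix a (scale_matrix b X) = scale_matrix (a * b) X" for a b and X :: "complex ^ 'n ^ 'n"
    by (simp add: vec_eq_iff map_matrix_def)
  have scale_one: "scale_matrix 1 X = X" for X :: "complex ^ 'n ^ 'n"
    by (simp add: vec_eq_iff map_matrix_def)
  have "?D e ** ?D' e = mat 1 \<and> ?D' e ** ?D e = mat 1" if "e \<in> E" for e
  proof -
    have "M0' ** poly_matrix M e ** (N e ** M0) = mat 1" "N e ** M0 ** (M0' ** poly_matrix M e) = mat 1"
      using inv[OF that] inv0 by (metis matrix_mul_assoc matrix_mul_lid)+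
    then show ?thesis
      using Q0[OF that]
      by (simp add: scale_matrix_mult_left scale_matrix_mult_right scale_scale scale_one)
  qed
  moreover have "(\<lambda>e. ?D e $ i $ j) \<in> rational_functions_over K E" for i j
  proof (rule rational_functions_overI)
    let ?p = "\<Sum>a\<in>UNIV. smult (M0' $ i $ a) (M $ a $ j)"
    have "?p \<in> {p. \<forall>i. coeff p i \<in> K}"
      using M M0'_mem by (intro KX.sum_mem smult_mem) auto
    then show "coeff ?p k \<in> K" for k
      by blast
    show "?D e $ i $ j = poly ?p e / poly Q e" for e
      by (simp add: matrix_matrix_mult_def map_matrix_def poly_matrix_def poly_sum
          divide_inverse sum_distrib_left mult_ac)
  qed (use Q Q0 in auto)
  moreover have "(\<lambda>e. ?D' e $ i $ j) \<in> rational_functions_over K E" for i j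
  proof (rule rational_functions_overI)
    \<comment> \<open>Numerator over the common denominator \<open>det M\<close>, with the inverse
      of \<open>M\<close> written through its adjugate.\<close>
    let ?p = "\<Sum>a\<in>UNIV. smult (M0 $ a $ j) (Q * cramer_matrix M $ i $ a)"
    have "cramer_matrix M $ i $ a \<in> {p. \<forall>i. coeff p i \<in> K}" for a
      using M by (intro KX.cramer_matrix_mem) auto
    then have "?p \<in> {p. \<forall>i. coeff p i \<in> K}"
      using M0_mem Q by (intro KX.sum_mem smult_mem KX.mult_mem) auto
    then show "coeff ?p k \<in> K" for k
      by blast
    show "?D' e $ i $ j = poly ?p e / poly (det M) e" for e
      by (simp add: matrix_matrix_mult_def map_matrix_def N_def poly_sum poly_det poly_cramer_matrix
          sum_divide_distrib sum_distrib_left mult_ac)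
    show "coeff (det M) k \<in> K" for k
      using KX.det_mem[of M] M by blast
    show "poly (det M) e \<noteq> 0" if "e \<in> E" for e
      using det_M[OF that] by (simp add: poly_det)
  qed
  ultimately have "?D \<in> GL_functions E (rational_functions_over K E)"
    unfolding GL_functions_def by (intro CollectI conjI exI[of _ ?D']) auto
  moreover have "M0 \<in> GL_field K"
    using M0_mem det_M0 by (simp add: GL_field_def invertible_det_nz)
  ultimately show thesis
    using inv0 by (intro that[of m M0']) (simp_all add: M0_def)
qed

section \<open>Assembling the factorisation of the intersection matrix\<close>

theorem theorem2:
  fixes K :: "complex set"
    and U :: "(complex ^ 'r::finite) set"
    and E :: "complex set"
    and \<A> :: "(complex ^ 'r \<Rightarrow> complex) set"
    and n :: int
    and P P' S S' C G G' \<Delta> :: "complex ^ 'r \<Rightarrow> complex \<Rightarrow> complex ^ 'n::finite ^ 'n"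
    and H :: "complex \<Rightarrow> complex ^ 'n ^ 'n"
    and \<Omega> \<Omega>' :: "complex ^ 'r \<Rightarrow> complex \<Rightarrow> (complex ^ 'n ^ 'n) ^ 'r"
    and A A' :: "complex ^ 'r \<Rightarrow> (complex ^ 'n ^ 'n) ^ 'r"
  assumes K: "number_field K"
    and U: "open U" "connected U" "U \<noteq> {}"
    and E: "open E" "E \<noteq> {}"
    and \<A>: "differential_algebra K U \<A>"
    \<comment> \<open>twisted periods, their duals, and their differential equations\<close>
    and P_invertible: "\<And>x e. x \<in> U \<Longrightarrow> e \<in> E \<Longrightarrow> invertible (P x e) \<and> invertible (P' x e)"
    and \<Omega>_rational: "\<And>k i j. (\<lambda>z. \<Omega> (fst z) (snd z) $ k $ i $ j) \<in> rational_on (U \<times> E) coords_eps"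
    and \<Omega>'_rational: "\<And>k i j. (\<lambda>z. \<Omega>' (fst z) (snd z) $ k $ i $ j) \<in> rational_on (U \<times> E) coords_eps"
    and dP: "\<And>x e. x \<in> U \<Longrightarrow> e \<in> E \<Longrightarrow>
      has_matrix_differential (\<lambda>y. P y e) (\<chi> k. \<Omega> x e $ k ** P x e) x"
    and dP': "\<And>x e. x \<in> U \<Longrightarrow> e \<in> E \<Longrightarrow>
      has_matrix_differential (\<lambda>y. P' y e) (\<chi> k. \<Omega>' x e $ k ** P' x e) x"
    \<comment> \<open>intersection matrices and the twisted Riemann bilinear relations\<close>
    and H_invertible: "\<And>e. e \<in> E \<Longrightarrow> invertible (H e)"
    and C_invertible: "\<And>x e. x \<in> U \<Longrightarrow> e \<in> E \<Longrightarrow> invertible (C x e)"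
    and C_rational: "\<And>e i j. e \<in> E \<Longrightarrow> (\<lambda>x. C x e $ i $ j) \<in> rational_on U coords"
    and bilinear: "\<And>x e. x \<in> U \<Longrightarrow> e \<in> E \<Longrightarrow>
      scale_matrix ((2 * of_real pi * \<i>) powi (- n))
        (P x e ** transpose (matrix_inv (H e)) ** transpose (P' x e)) = C x e"
    and dC: "\<And>x e. x \<in> U \<Longrightarrow> e \<in> E \<Longrightarrow>
      has_matrix_differential (\<lambda>y. C y e)
        (\<chi> k. \<Omega> x e $ k ** C x e + C x e ** transpose (\<Omega>' x e $ k)) x"
    \<comment> \<open>change of bases to the epsilon-factorised equations\<close>
    and S_invertible: "\<And>x e. x \<in> U \<Longrightarrow> e \<in> E \<Longrightarrow> invertible (S x e) \<and> invertible (S' x e)"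
    and G: "\<And>x e. x \<in> U \<Longrightarrow> e \<in> E \<Longrightarrow> G x e = matrix_inv (S x e) ** P x e"
    and G': "\<And>x e. x \<in> U \<Longrightarrow> e \<in> E \<Longrightarrow> G' x e = matrix_inv (S' x e) ** P' x e"
    and dG: "\<And>x e. x \<in> U \<Longrightarrow> e \<in> E \<Longrightarrow>
      has_matrix_differential (\<lambda>y. G y e) (\<chi> k. scale_matrix e (A x $ k) ** G x e) x"
    and dG': "\<And>x e. x \<in> U \<Longrightarrow> e \<in> E \<Longrightarrow>
      has_matrix_differential (\<lambda>y. G' y e) (\<chi> k. scale_matrix e (A' x $ k) ** G' x e) x"
    and A_closed: "\<And>i j. matrix_form_entry A i j \<in> closed_forms U \<A>"
    and A'_closed: "\<And>i j. matrix_form_entry A' i j \<in> closed_forms U \<A>"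
    and A_flat: "wedge_square_zero U A"
    and A'_flat: "wedge_square_zero U A'"
    and C_form: "jointly_in_C_form K U \<A> A A'"
    \<comment> \<open>the intersection matrix in the new bases\<close>
    and \<Delta>: "\<And>x e. x \<in> U \<Longrightarrow> e \<in> E \<Longrightarrow>
      \<Delta> x e = matrix_inv (S x e) ** C x e ** transpose (matrix_inv (S' x e))"
    and \<Delta>_GL: "(\<lambda>z. \<Delta> (fst z) (snd z)) \<in> GL_functions (U \<times> E) (algebra_eps K U \<A> E)"
  shows "\<exists>\<Delta>\<^sub>0 \<Delta>t.
      \<Delta>\<^sub>0 \<in> GL_field K \<and>
      \<Delta>t \<in> GL_functions E (rational_functions_over K E) \<and>
      (\<forall>x\<in>U. \<forall>e\<in>E. \<Delta> x e = \<Delta>\<^sub>0 ** \<Delta>t e) \<and>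
      (\<forall>x\<in>U. \<forall>e\<in>E. \<forall>k. \<Delta>t e ** transpose (A' x $ k) = transpose (A' x $ k) ** \<Delta>t e)"
proof -
  have infinite_E: "infinite E"
    using E finite_imp_not_open by blast
  define c where "c = (2 * of_real pi * \<i> :: complex) powi (- n)"
  \<comment> \<open>The base changes turn \<open>P\<close> and \<open>P'\<close> into
    \<open>G\<close> and \<open>G'\<close>; the power of \<open>2 pi i\<close> is absorbed into the
    constant middle factor.\<close>
  have \<Delta>_bilinear: "\<Delta> x e = G x e ** scale_matrix c (transpose (matrix_inv (H e))) ** transpose (G' x e)"
    if "x \<in> U" "e \<in> E" for x e
    by (simp add: \<Delta>[OF that] bilinear[OF that, symmetric] G[OF that] G'[OF that] c_def
        scale_matrix_mult_left scale_matrix_mult_right matrix_transpose_mul matrix_mul_assoc)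
  have d\<Delta>: "has_matrix_differential (\<lambda>y. \<Delta> y e)
      (\<chi> k. scale_matrix e (A x $ k ** \<Delta> x e + \<Delta> x e ** transpose (A' x $ k))) x"
    if "x \<in> U" "e \<in> E" for x e
    using has_matrix_differential_transform[OF has_matrix_differential_bilinear[OF dG[OF that] dG'[OF that]]
        U(1) that(1) \<Delta>_bilinear[OF _ that(2), symmetric]]
    by (simp only: \<Delta>_bilinear[OF that])
  \<comment> \<open>Indexing entries by pairs lets a single denominator \<open>Q\<close> serve the
    whole matrix.\<close>
  have entries: "(\<lambda>z. \<Delta> (fst z) (snd z) $ fst p $ snd p) \<in> algebra_eps K U \<A> E" for p :: "'n \<times> 'n"
    using \<Delta>_GL unfolding GL_functions_def by blast
  obtain Q h where Q: "\<And>k. coeff Q k \<in> K" "\<And>e. e \<in> E \<Longrightarrow> poly Q e \<noteq> 0"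
    and h: "\<And>p. h p \<in> poly_families \<A>"
    and Qh: "\<And>p x e. x \<in> U \<Longrightarrow> e \<in> E \<Longrightarrow> poly Q e * \<Delta> x e $ fst p $ snd p = poly (h p x) e"
    by (rule algebra_eps_common_denominator[OF K \<A>,
        of "\<lambda>p z. \<Delta> (fst z) (snd z) $ fst p $ snd p" E, OF entries, unfolded fst_conv snd_conv])
      blast
  define Hm where "Hm x = (\<chi> i j. h (i, j) x)" for x
  have Hm: "poly_matrix (Hm x) e = scale_matrix (poly Q e) (\<Delta> x e)" if "x \<in> U" "e \<in> E" for x e
    using Qh[OF that, of "(_, _)"] by (simp add: vec_eq_iff poly_matrix_def Hm_def map_matrix_def)
  have dHm: "has_matrix_differential (\<lambda>y. poly_matrix (Hm y) e)
      (\<chi> l. scale_matrix e (A x $ l ** poly_matrix (Hm x) e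
        + poly_matrix (Hm x) e ** transpose (A' x $ l))) x" if "x \<in> U" "e \<in> E" for x e
  proof -
    have "has_matrix_differential (\<lambda>y. scale_matrix (poly Q e) (\<Delta> y e))
        (\<chi> l. scale_matrix e (A x $ l ** poly_matrix (Hm x) e
          + poly_matrix (Hm x) e ** transpose (A' x $ l))) x"
      using has_matrix_differential_scale[OF d\<Delta>[OF that], of "poly Q e"]
      by (simp add: Hm[OF that] scale_matrix_mult_left scale_matrix_mult_right
          scale_matrix_add scale_matrix_commute)
    then show ?thesis
      by (rule has_matrix_differential_transform[OF _ U(1) that(1)]) (rule Hm[OF _ that(2), symmetric])
  qed
  have Hm_mem: "(\<lambda>y. Hm y $ i $ j) \<in> poly_families \<A>" for i j
    using h by (simp add: Hm_def)
  obtain M where M: "\<And>i j k. coeff (M $ i $ j) k \<in> K" and Hm_M: "\<And>x. x \<in> U \<Longrightarrow> Hm x = M"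
    and AM: "\<And>x l e. x \<in> U \<Longrightarrow> A x $ l ** poly_matrix M e = - (poly_matrix M e ** transpose (A' x $ l))"
    by (rule poly_matrix_constant[OF infinite_E K \<A> U C_form Hm_mem dHm]) blast+
  have \<Delta>_M: "\<Delta> x e = scale_matrix (inverse (poly Q e)) (poly_matrix M e)" if "x \<in> U" "e \<in> E" for x e
    using Hm[OF that] Hm_M[OF that(1)] Q(2)[OF that(2)] by (simp add: vec_eq_iff map_matrix_def)
  \<comment> \<open>On \<open>E\<close> the matrix \<open>M(e)\<close> is a nonzero multiple of the
    invertible \<open>\<Delta>\<close>.\<close>
  have det_M: "det (poly_matrix M e) \<noteq> 0" if "e \<in> E" for e
  proof -
    obtain x where x: "x \<in> U"
      using U by blast
    have "(x, e) \<in> U \<times> E"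
      using x that by blast
    with \<Delta>_GL obtain N where "\<Delta> x e ** N = mat 1"
      unfolding GL_functions_def by force
    then have "poly_matrix M e ** scale_matrix (inverse (poly Q e)) N = mat 1"
      by (simp add: \<Delta>_M[OF x that] scale_matrix_mult_left scale_matrix_mult_right)
    then show ?thesis
      by (metis invertible_def invertible_det_nz matrix_left_right_inverse)
  qed
  obtain m :: nat and \<Delta>\<^sub>0' where \<Delta>\<^sub>0: "poly_matrix M (of_nat m) \<in> GL_field K"
    and inv: "poly_matrix M (of_nat m) ** \<Delta>\<^sub>0' = mat 1" "\<Delta>\<^sub>0' ** poly_matrix M (of_nat m) = mat 1"
    and \<Delta>t: "(\<lambda>e. \<Delta>\<^sub>0' ** scale_matrix (inverse (poly Q e)) (poly_matrix M e))
      \<in> GL_functions E (rational_functions_over K E)"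
    using factorise_poly_matrix[OF K E(2) M Q det_M] by blast
  show ?thesis
  proof (intro exI conjI ballI allI)
    fix x e k assume x: "x \<in> U" and e: "e \<in> E"
    show "\<Delta> x e = poly_matrix M (of_nat m)
        ** (\<Delta>\<^sub>0' ** scale_matrix (inverse (poly Q e)) (poly_matrix M e))"
      by (simp add: \<Delta>_M[OF x e] matrix_mul_assoc inv)
    show "\<Delta>\<^sub>0' ** scale_matrix (inverse (poly Q e)) (poly_matrix M e) ** transpose (A' x $ k)
        = transpose (A' x $ k) ** (\<Delta>\<^sub>0' ** scale_matrix (inverse (poly Q e)) (poly_matrix M e))"
      \<comment> \<open>The relation is applied at \<open>m\<close>, which may lie outside
        \<open>E\<close>, and at \<open>e\<close>; the scalar \<open>1 / Q(e)\<close> then pulls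
        out.\<close>
      using intertwiner_quotient_commutes[OF AM[OF x, of k "of_nat m"] AM[OF x, of k e] inv(2,1)]
      by (simp add: scale_matrix_mult_left scale_matrix_mult_right)
  qed (fact \<Delta>\<^sub>0 \<Delta>t)+
qed

end
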